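(* Let $M=(S,P,I,AP,L)$ be a possibilistic Kripke structure and let $B,C\subseteq S$. Let $S_{=0},S_{=1},S_{?}$ be a partition of $S$ such that (1) $B\subseteq S_{=1}\subseteq\{s\in S\mid Po(s\models C\,\mathsf{U}\,B)=1\}$; (2) $S\setminus(C\cup B)\subseteq S_{=0}\subseteq\{s\in S\mid Po(s\models C\,\mathsf{U}\,B)=0\}$; (3) $S_{?}=S\setminus(S_{=1}\cup S_{=0})$. Let $A=(P(s,t))_{s,t\in S_?}$ and $b=(b_s)_{s\in S_?}$ with $b_s=P(s,S_{=1})=\bigvee_{u\in S_{=1}}P(s,u)$, and define $\Phi:[0,1]^{S_?}\to[0,1]^{S_?}$ by $\Phi(Y)=(A\circ Y)\vee b$, i.e. $\Phi(Y)_s=\bigvee_{t\in S_?}\big(P(s,t)\wedge y_t\big)\vee b_s$ for $Y=(y_t)_{t\in S_?}$ and $s\in S_?$. Then: (i) The vector $X=(Po(s\models C\,\mathsf{U}\,B))_{s\in S_?}$ is the least fixed point of $\Phi$ (with respect to the pointwise order on $[0,1]^{S_?}$). (ii) Let $X^{(0)}=0$ be the vector consisting of zeros only and, for $n\ge 0$, $X^{(n+1)}=\Phi(X^{(n)})$. Then (ii-1) $X^{(n)}=(x^{(n)}_s)_{s\in S_?}$, where $x^{(n)}_s=Po(s\models C\,\mathsf{U}^{\le n}S_{=1})$ for each $s\in S_?$ and each $n\geq 0$; (ii-2) $X^{(0)}\le X^{(1)}\le X^{(2)}\le\cdots\le X$; (ii-3) $X=\lim_{n\to\infty}X^{(n)}$,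 meaning that $x_s=\lim_{n\to\infty}x_s^{(n)}$ for every $s\in S_?$, where $X=(x_s)_{s\in S_?}$.
   Context: For subsets or families in $[0,1]$, $\vee$ denotes supremum and $\wedge$ infimum. A possibilistic Kripke structure is a tuple $M=(S,P,I,AP,L)$ where $S$ is a countable nonempty set of states; $P:S\times S\to[0,1]$ satisfies $\bigvee_{s'\in S}P(s,s')=1$ for all $s\in S$; $I:S\to[0,1]$ satisfies $\bigvee_{s\in S}I(s)=1$; $AP$ is a set of atomic propositions; and $L:S\to 2^{AP}$ is a labeling function. For $T\subseteq S$, $P(s,T)=\bigvee_{t\in T}P(s,t)$. A path of $M$ is an infinite sequence $\pi=s_0s_1s_2\cdots\in S^\omega$ with $P(s_i,s_{i+1})>0$ for all $i\ge 0$; $Paths(M)$ is the set of all paths and $Paths(s)$ the set of those with $s_0=s$. Define $Po^M(\pi)=I(s_0)\wedge\bigwedge_{i=0}^\infty P(s_i,s_{i+1})$ for $\pi=s_0s_1\cdots\in Paths(M)$, and $Po^M(E)=\bigvee\{Po^M(\pi)\mid\pi\in E\}$ for $E\subseteq Paths(M)$ (with $\bigvee\emptyset=0$). For a state $s$, $M_s$ is the structure obtained from $M$ by replacing $I$ with the initial distribution that is $1$ at $s$ and $0$ elsewhere. For an event (set of paths) $E$, $Po(s\models E)=Po^{M_s}(E\cap Paths(s))$. For $C,D\subseteq S$ and $n\ge0$: $C\,\mathsf{U}\,D$ is the set of paths $s_0s_1\cdots$ for which there is $k\ge 0$ with $s_k\in D$ and $s_i\in C$ for all $0\le i<k$; $C\,\mathsf{U}^{\le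 n}D$ is the set of paths for which such a $k$ exists with $k\le n$. *)

theory Defs
  imports Complex_Main "HOL-Library.Countable_Set" "HOL-Library.FuncSet"
begin

text \<open>Suprema are taken in the lattice [0,1], so the supremum of the empty set is 0;
  on the reals \<^term>\<open>Sup {}\<close> is unspecified.\<close>

definition usup :: "real set \<Rightarrow> real" where
  "usup A = (if A = {} then 0 else Sup A)"

record ('s, 'p) kripke =
  states :: "'s set"
  trans_poss :: "'s \<Rightarrow> 's \<Rightarrow> real"
  init_poss :: "'s \<Rightarrow> real"
  atoms :: "'p set"
  labels :: "'s \<Rightarrow> 'p set"

definition possibilistic_kripke :: "('s, 'p) kripke \<Rightarrow> bool" where
  "possibilistic_kripke M \<longleftrightarrow>
     countable (states M) \<and> states M \<noteq> {} \<and>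
     (\<forall>s\<in>states M. \<forall>t\<in>states M. trans_poss M s t \<in> {0..1}) \<and>
     (\<forall>s\<in>states M. usup (trans_poss M s ` states M) = 1) \<and>
     (\<forall>s\<in>states M. init_poss M s \<in> {0..1}) \<and>
     usup (init_poss M ` states M) = 1 \<and>
     (\<forall>s\<in>states M. labels M s \<subseteq> atoms M)"

definition trans_set :: "('s, 'p) kripke \<Rightarrow> 's \<Rightarrow> 's set \<Rightarrow> real" where
  "trans_set M s T = usup (trans_poss M s ` T)"

definition paths :: "('s, 'p) kripke \<Rightarrow> (nat \<Rightarrow> 's) set" where
  "paths M = {\<pi>. (\<forall>i. \<pi> i \<in> states M) \<and> (\<forall>i. trans_poss M (\<pi> i) (\<pi> (Suc i)) > 0)}"

definition paths_from :: "('s, 'p) kripke \<Rightarrow> 's \<Rightarrow> (nat \<Rightarrow> 's) set" where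
  "paths_from M s = {\<pi> \<in> paths M. \<pi> 0 = s}"

definition path_poss :: "('s, 'p) kripke \<Rightarrow> (nat \<Rightarrow> 's) \<Rightarrow> real" where
  "path_poss M \<pi> = min (init_poss M (\<pi> 0)) (INF i. trans_poss M (\<pi> i) (\<pi> (Suc i)))"

definition event_poss :: "('s, 'p) kripke \<Rightarrow> (nat \<Rightarrow> 's) set \<Rightarrow> real" where
  "event_poss M E = usup (path_poss M ` E)"

definition start_at :: "('s, 'p) kripke \<Rightarrow> 's \<Rightarrow> ('s, 'p) kripke" where
  "start_at M s = M\<lparr>init_poss := (\<lambda>t. if t = s then 1 else 0)\<rparr>"

definition state_poss :: "('s, 'p) kripke \<Rightarrow> 's \<Rightarrow> (nat \<Rightarrow> 's) set \<Rightarrow> real" where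
  "state_poss M s E = event_poss (start_at M s) (E \<inter> paths_from M s)"

definition until :: "('s, 'p) kripke \<Rightarrow> 's set \<Rightarrow> 's set \<Rightarrow> (nat \<Rightarrow> 's) set" where
  "until M C D = {\<pi> \<in> paths M. \<exists>k. \<pi> k \<in> D \<and> (\<forall>i<k. \<pi> i \<in> C)}"

definition bounded_until ::
    "('s, 'p) kripke \<Rightarrow> 's set \<Rightarrow> nat \<Rightarrow> 's set \<Rightarrow> (nat \<Rightarrow> 's) set" where
  "bounded_until M C n D = {\<pi> \<in> paths M. \<exists>k\<le>n. \<pi> k \<in> D \<and> (\<forall>i<k. \<pi> i \<in> C)}"

text \<open>A vector indexed by \<^term>\<open>T\<close> with entries in [0,1] is an element of
  \<^term>\<open>T \<rightarrow>\<^sub>E {0..1::real}\<close>, i.e. it is undefined outside \<^term>\<open>T\<close>;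
  equality of such functions is then equality of vectors.\<close>

definition maxmin_prod :: "'s set \<Rightarrow> ('s \<Rightarrow> 's \<Rightarrow> real) \<Rightarrow> ('s \<Rightarrow> real) \<Rightarrow> 's \<Rightarrow> real" where
  "maxmin_prod T A Y = (\<lambda>s\<in>T. usup ((\<lambda>t. min (A s t) (Y t)) ` T))"

definition maxmin_affine ::
    "'s set \<Rightarrow> ('s \<Rightarrow> 's \<Rightarrow> real) \<Rightarrow> ('s \<Rightarrow> real) \<Rightarrow> ('s \<Rightarrow> real) \<Rightarrow> 's \<Rightarrow> real" where
  "maxmin_affine T A b Y = (\<lambda>s\<in>T. max (maxmin_prod T A Y s) (b s))"

lemma usup_unit: "A \<subseteq> {0..1} \<Longrightarrow> usup A \<in> {0..1}"
proof (cases "A = {}")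
  case False
  assume A: "A \<subseteq> {0..1}"
  from False obtain a where a: "a \<in> A" by blast
  have "bdd_above A" using A by (meson bdd_above_Icc bdd_above_mono)
  then have "a \<le> Sup A" using a by (rule cSup_upper[rotated])
  moreover have "Sup A \<le> 1" using A False by (intro cSup_least) auto
  moreover have "0 \<le> a" using A a by auto
  ultimately show ?thesis using False by (simp add: usup_def)
qed (simp add: usup_def)

lemma maxmin_affine_closed:
  assumes "\<And>s t. s \<in> T \<Longrightarrow> t \<in> T \<Longrightarrow> A s t \<in> {0..1}"
    and "b \<in> T \<rightarrow>\<^sub>E {0..1}" and "Y \<in> T \<rightarrow>\<^sub>E {0..1}"
  shows "maxmin_affine T A b Y \<in> T \<rightarrow>\<^sub>E {0..1}"
proof (rule PiE_I)
  fix s assume s: "s \<in> T"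
  have "usup ((\<lambda>t. min (A s t) (Y t)) ` T) \<in> {0..1}"
    using assms(1)[OF s] PiE_mem[OF assms(3)] by (intro usup_unit) (auto simp: min_def)
  then show "maxmin_affine T A b Y s \<in> {0..1}"
    using s PiE_mem[OF assms(2) s] by (auto simp: maxmin_affine_def maxmin_prod_def)
qed (simp add: maxmin_affine_def)

lemma possibilistic_kripke_start_at:
  assumes "possibilistic_kripke M" and "s \<in> states M"
  shows "possibilistic_kripke (start_at M s)"
proof -
  let ?I = "(\<lambda>t. if t = s then 1 else 0 :: real) ` states M"
  have "Sup ?I = 1" using assms(2) by (intro cSup_eq_maximum) auto
  then have "usup ?I = 1" using assms(2) by (auto simp: usup_def)
  then show ?thesis using assms
    by (simp add: possibilistic_kripke_def start_at_def)
qed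

end

theory Submission
  imports Defs
begin

text \<open>For an event that is decided by the tail of a path, the possibility at \<open>s\<close> is the supremum
  over \<open>t\<close> of the minimum of \<open>P(s,t)\<close> and the possibility at \<open>t\<close>; no limit process is involved, because minimum
  distributes over suprema. Hence \<open>x = Po(C U B)\<close> and \<open>p n = Po(C U\<^sup>\<le>\<^sup>n S1)\<close> satisfy the same one-step
  recursion on \<open>C - S1\<close>. Both equal 1 on \<open>S1\<close>, where \<open>p n = 1\<close> needs that infinite paths of possibility
  arbitrarily close to 1 start in every state. Induction gives \<open>p n \<le> x\<close> on all states, so \<open>p n\<close>
  vanishes on \<open>S0\<close>, and restricting the recursion to \<open>Sq\<close> yields \<open>\<Phi>\<close>. Finally, every path in \<open>C U B\<close>
  lies in some \<open>C U\<^sup>\<le>\<^sup>n S1\<close>, so \<open>x\<close> is the supremum of the \<open>p n\<close>, which lie below every fixed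
  point.\<close>

section \<open>Suprema of subsets of the unit interval\<close>

lemma usup_upper: "A \<subseteq> {0..1} \<Longrightarrow> a \<in> A \<Longrightarrow> a \<le> usup A"
  unfolding usup_def by (auto intro!: cSup_upper bdd_above_mono[OF bdd_above_Icc])

text \<open>The bound \<open>0 \<le> c\<close> covers the empty set, whose \<open>usup\<close> is 0.
  Later arguments about suprema go through such pointwise upper bounds, so no supremum has to be
  attained.\<close>

lemma usup_le_iff:
  assumes "A \<subseteq> {0..1}" "0 \<le> c"
  shows "usup A \<le> c \<longleftrightarrow> (\<forall>a\<in>A. a \<le> c)"
proof
  assume "usup A \<le> c"
  then show "\<forall>a\<in>A. a \<le> c" using usup_upper[OF assms(1)] by fastforce
next
  assume "\<forall>a\<in>A. a \<le> c"
  then show "usup A \<le> c" using assms(2) by (auto simp: usup_def intro!: cSup_least)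
qed

lemma usup_image_mono:
  assumes "\<And>t. t \<in> T \<Longrightarrow> f t \<in> {0..1}" "\<And>t. t \<in> T \<Longrightarrow> g t \<in> {0..1}"
    and "\<And>t. t \<in> T \<Longrightarrow> f t \<le> g t"
  shows "usup (f ` T) \<le> usup (g ` T)"
proof -
  have g: "g ` T \<subseteq> {0..1}" using assms(2) by auto
  have "f t \<le> usup (g ` T)" if "t \<in> T" for t
    using assms(3)[OF that] usup_upper[OF g, of "g t"] that by auto
  moreover have "f ` T \<subseteq> {0..1}" using assms(1) by auto
  ultimately show ?thesis using usup_unit[OF g] by (subst usup_le_iff) auto
qed

lemma usup_Un:
  assumes "A \<subseteq> {0..1}" "B \<subseteq> {0..1}"
  shows "usup (A \<union> B) = max (usup A) (usup B)"
proof (rule antisym)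
  have AB: "A \<union> B \<subseteq> {0..1}" using assms by auto
  have "0 \<le> max (usup A) (usup B)" using usup_unit[OF assms(1)] by auto
  then show "usup (A \<union> B) \<le> max (usup A) (usup B)"
    using usup_upper[OF assms(1)] usup_upper[OF assms(2)]
    by (subst usup_le_iff[OF AB]) (auto simp: le_max_iff_disj)
  show "max (usup A) (usup B) \<le> usup (A \<union> B)"
    using usup_unit[OF AB] usup_upper[OF AB]
    by (auto simp: usup_le_iff[OF assms(1)] usup_le_iff[OF assms(2)])
qed

section \<open>Possibility of a single path\<close>

lemma trans_poss_unit:
  "possibilistic_kripke M \<Longrightarrow> s \<in> states M \<Longrightarrow> t \<in> states M \<Longrightarrow> trans_poss M s t \<in> {0..1}"
  unfolding possibilistic_kripke_def by blast

text \<open>Leaving out the initial factor of \<open>path_poss\<close> makes the value independent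
  of a start state, so it can be compared between a path and its tail.\<close>

definition run_poss :: "('s, 'p) kripke \<Rightarrow> (nat \<Rightarrow> 's) \<Rightarrow> real" where
  "run_poss M \<pi> = (INF i. trans_poss M (\<pi> i) (\<pi> (Suc i)))"

lemma bdd_below_run:
  "possibilistic_kripke M \<Longrightarrow> \<pi> \<in> paths M \<Longrightarrow> bdd_below (range (\<lambda>i. trans_poss M (\<pi> i) (\<pi> (Suc i))))"
  by (rule bdd_belowI[of _ 0]) (auto simp: paths_def less_imp_le)

lemma run_poss_unit:
  assumes "possibilistic_kripke M" "\<pi> \<in> paths M"
  shows "run_poss M \<pi> \<in> {0..1}"
proof -
  have "trans_poss M (\<pi> 0) (\<pi> (Suc 0)) \<in> {0..1}"
    using assms by (intro trans_poss_unit) (auto simp: paths_def)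
  moreover have "run_poss M \<pi> \<le> trans_poss M (\<pi> 0) (\<pi> (Suc 0))"
    unfolding run_poss_def by (rule cINF_lower[OF bdd_below_run[OF assms]]) simp
  moreover have "0 \<le> run_poss M \<pi>"
    unfolding run_poss_def using assms(2) by (intro cINF_greatest) (auto simp: paths_def less_imp_le)
  ultimately show ?thesis by auto
qed

lemma run_poss_step:
  assumes "possibilistic_kripke M" "\<pi> \<in> paths M"
  shows "run_poss M \<pi> = min (trans_poss M (\<pi> 0) (\<pi> 1)) (run_poss M (\<lambda>i. \<pi> (Suc i)))"
proof -
  let ?f = "\<lambda>i. trans_poss M (\<pi> i) (\<pi> (Suc i))"
  have "bdd_below (?f ` range Suc)"
    using bdd_below_run[OF assms] by (rule bdd_below_mono) auto
  then have "Inf (insert (?f 0) (?f ` range Suc)) = inf (?f 0) (Inf (?f ` range Suc))"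
    by (intro cInf_insert) auto
  moreover have "range ?f = insert (?f 0) (?f ` range Suc)"
  proof -
    have "UNIV = insert 0 (range Suc)" by (auto simp flip: greaterThan_0)
    from arg_cong[OF this, of "image ?f"] show ?thesis by (simp only: image_insert)
  qed
  ultimately show ?thesis
    unfolding run_poss_def inf_min by (simp only: image_image One_nat_def)
qed

section \<open>Possibility of events and one-step recursion\<close>

lemma state_poss_eq:
  assumes "possibilistic_kripke M"
  shows "state_poss M s E = usup (run_poss M ` (E \<inter> paths_from M s))"
proof -
  \<comment> \<open>The initial factor is 1 at \<open>s\<close>, and \<open>run_poss\<close> is at
    most 1, so the minimum absorbs it.\<close>
  have "path_poss (start_at M s) \<pi> = run_poss M \<pi>" if "\<pi> \<in> E \<inter> paths_from M s" for \<pi>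
    using run_poss_unit[OF assms, of \<pi>] that
    by (auto simp: path_poss_def run_poss_def start_at_def paths_from_def)
  then show ?thesis by (simp add: state_poss_def event_poss_def)
qed

lemma run_poss_image_unit:
  "possibilistic_kripke M \<Longrightarrow> run_poss M ` (E \<inter> paths_from M s) \<subseteq> {0..1}"
  by (intro image_subsetI run_poss_unit) (auto simp: paths_from_def)

lemma state_poss_unit: "possibilistic_kripke M \<Longrightarrow> state_poss M s E \<in> {0..1}"
  unfolding state_poss_eq by (intro usup_unit run_poss_image_unit)

lemma run_le_state_poss:
  "possibilistic_kripke M \<Longrightarrow> \<pi> \<in> E \<Longrightarrow> \<pi> \<in> paths_from M s \<Longrightarrow> run_poss M \<pi> \<le> state_poss M s E"
  unfolding state_poss_eq by (rule usup_upper[OF run_poss_image_unit]) auto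

lemma state_poss_le_iff:
  "possibilistic_kripke M \<Longrightarrow> 0 \<le> c \<Longrightarrow>
    state_poss M s E \<le> c \<longleftrightarrow> (\<forall>\<pi>\<in>E \<inter> paths_from M s. run_poss M \<pi> \<le> c)"
  unfolding state_poss_eq by (subst usup_le_iff[OF run_poss_image_unit]) auto

lemma state_poss_mono:
  assumes "possibilistic_kripke M" "E \<subseteq> F"
  shows "state_poss M s E \<le> state_poss M s F"
proof -
  have "0 \<le> state_poss M s F" using state_poss_unit[OF assms(1)] by auto
  then show ?thesis
    using assms(2) run_le_state_poss[OF assms(1)] by (auto simp: state_poss_le_iff[OF assms(1)])
qed

text \<open>Assumption \<open>E\<close> says that the event is decided by the tail. One inequality
  splits off the first transition of a path; the other prepends \<open>s\<close> to paths from a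
  successor.\<close>

lemma state_poss_step:
  assumes K: "possibilistic_kripke M" and s: "s \<in> states M"
    and E: "\<And>\<pi>. \<pi> \<in> paths_from M s \<Longrightarrow> \<pi> \<in> E \<longleftrightarrow> (\<lambda>i. \<pi> (Suc i)) \<in> F"
  shows "state_poss M s E = usup ((\<lambda>t. min (trans_poss M s t) (state_poss M t F)) ` states M)"
    (is "_ = usup (?g ` _)")
proof (rule antisym)
  have g: "?g ` states M \<subseteq> {0..1}"
    using trans_poss_unit[OF K s] state_poss_unit[OF K, of _ F] by (auto simp: min_def)
  have "run_poss M \<pi> \<le> usup (?g ` states M)" if \<pi>: "\<pi> \<in> E" "\<pi> \<in> paths_from M s" for \<pi>
  proof -
    have path: "\<pi> \<in> paths M" and "\<pi> 0 = s" and t: "\<pi> 1 \<in> states M"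
      and tail: "(\<lambda>i. \<pi> (Suc i)) \<in> paths_from M (\<pi> 1)"
      using \<pi>(2) by (auto simp: paths_from_def paths_def)
    then have "run_poss M \<pi> \<le> ?g (\<pi> 1)"
      using run_poss_step[OF K path] run_le_state_poss[OF K _ tail, of F] E[OF \<pi>(2)] \<pi>(1)
      by (auto simp: min_def)
    also have "\<dots> \<le> usup (?g ` states M)" using t by (intro usup_upper[OF g]) auto
    finally show ?thesis .
  qed
  moreover have "0 \<le> usup (?g ` states M)" using usup_unit[OF g] by auto
  ultimately show "state_poss M s E \<le> usup (?g ` states M)"
    by (subst state_poss_le_iff[OF K]) auto
next
  let ?c = "state_poss M s E"
  have c: "0 \<le> ?c" using state_poss_unit[OF K] by auto
  have g: "?g ` states M \<subseteq> {0..1}"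
    using trans_poss_unit[OF K s] state_poss_unit[OF K, of _ F] by (auto simp: min_def)
  \<comment> \<open>Only the case \<open>P(s,t) > ?c\<close> needs work. There the minimum of
    \<open>P(s,t)\<close> and the possibility of a run from \<open>t\<close> can be at most
    \<open>?c\<close> only if the latter is.\<close>
  have "?g t \<le> ?c" if t: "t \<in> states M" for t
  proof (cases "trans_poss M s t \<le> ?c")
    case False
    have "run_poss M \<rho> \<le> ?c" if \<rho>: "\<rho> \<in> F" "\<rho> \<in> paths_from M t" for \<rho>
    proof -
      let ?\<pi> = "case_nat s \<rho>"
      \<comment> \<open>The new first transition is positive since \<open>P(s,t) > ?c\<close> and
        \<open>?c \<ge> 0\<close>.\<close>
      have path: "?\<pi> \<in> paths_from M s"
        using \<rho>(2) s t False c by (auto simp: paths_from_def paths_def split: nat.splits)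
      then have "run_poss M ?\<pi> \<le> ?c"
        using E[OF path] \<rho>(1) by (intro run_le_state_poss[OF K]) auto
      moreover have "run_poss M ?\<pi> = min (trans_poss M s t) (run_poss M \<rho>)"
        using run_poss_step[OF K, of ?\<pi>] path \<rho>(2) by (simp add: paths_from_def)
      ultimately show ?thesis using False by (auto simp: min_def split: if_splits)
    qed
    then have "state_poss M t F \<le> ?c" by (subst state_poss_le_iff[OF K c]) auto
    then show ?thesis by simp
  qed simp
  then show "usup (?g ` states M) \<le> ?c" by (subst usup_le_iff[OF g c]) auto
qed

text \<open>Since \<open>s \<notin> D\<close>, a witness \<open>k\<close> is positive and can be
  shifted down to the tail; since \<open>s \<in> C\<close>, a witness of the tail can be shifted
  back up.\<close>

lemma state_poss_until_step:
  assumes "possibilistic_kripke M" "s \<in> states M" "s \<in> C" "s \<notin> D"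
  shows "state_poss M s (until M C D) =
    usup ((\<lambda>t. min (trans_poss M s t) (state_poss M t (until M C D))) ` states M)"
proof (rule state_poss_step[OF assms(1,2)])
  fix \<pi> assume \<pi>: "\<pi> \<in> paths_from M s"
  have "(\<exists>k. \<pi> k \<in> D \<and> (\<forall>i<k. \<pi> i \<in> C)) \<longleftrightarrow>
      (\<exists>k. \<pi> (Suc k) \<in> D \<and> (\<forall>i<k. \<pi> (Suc i) \<in> C))" (is "?L \<longleftrightarrow> ?R")
  proof
    assume ?L
    then obtain k where k: "\<pi> k \<in> D" "\<forall>i<k. \<pi> i \<in> C" by blast
    then have "k \<noteq> 0" using \<pi> assms(4) by (auto simp: paths_from_def intro!: gr0I)
    then obtain j where "k = Suc j" using not0_implies_Suc by blast
    then show ?R using k by auto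
  next
    assume ?R
    then obtain k where "\<pi> (Suc k) \<in> D" "\<forall>i<k. \<pi> (Suc i) \<in> C" by blast
    then show ?L using \<pi> assms(3)
      by (intro exI[of _ "Suc k"]) (auto simp: paths_from_def All_less_Suc2)
  qed
  then show "\<pi> \<in> until M C D \<longleftrightarrow> (\<lambda>i. \<pi> (Suc i)) \<in> until M C D"
    using \<pi> by (auto simp: until_def paths_from_def paths_def)
qed

text \<open>The same shift of the witness; passing to the tail uses up one unit of the
  bound.\<close>

lemma state_poss_bounded_until_step:
  assumes "possibilistic_kripke M" "s \<in> states M" "s \<in> C" "s \<notin> D"
  shows "state_poss M s (bounded_until M C (Suc n) D) =
    usup ((\<lambda>t. min (trans_poss M s t) (state_poss M t (bounded_until M C n D))) ` states M)"
proof (rule state_poss_step[OF assms(1,2)])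
  fix \<pi> assume \<pi>: "\<pi> \<in> paths_from M s"
  have "(\<exists>k\<le>Suc n. \<pi> k \<in> D \<and> (\<forall>i<k. \<pi> i \<in> C)) \<longleftrightarrow>
      (\<exists>k\<le>n. \<pi> (Suc k) \<in> D \<and> (\<forall>i<k. \<pi> (Suc i) \<in> C))" (is "?L \<longleftrightarrow> ?R")
  proof
    assume ?L
    then obtain k where k: "k \<le> Suc n" "\<pi> k \<in> D" "\<forall>i<k. \<pi> i \<in> C" by blast
    then have "k \<noteq> 0" using \<pi> assms(4) by (auto simp: paths_from_def intro!: gr0I)
    then obtain j where "k = Suc j" using not0_implies_Suc by blast
    then show ?R using k by auto
  next
    assume ?R
    then obtain k where "k \<le> n" "\<pi> (Suc k) \<in> D" "\<forall>i<k. \<pi> (Suc i) \<in> C" by blast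
    then show ?L using \<pi> assms(3)
      by (intro exI[of _ "Suc k"]) (auto simp: paths_from_def All_less_Suc2)
  qed
  then show "\<pi> \<in> bounded_until M C (Suc n) D \<longleftrightarrow> (\<lambda>i. \<pi> (Suc i)) \<in> bounded_until M C n D"
    using \<pi> by (auto simp: bounded_until_def paths_from_def paths_def)
qed

section \<open>Existence of paths and boundary values\<close>

lemma state_poss_paths:
  assumes K: "possibilistic_kripke M" and s: "s \<in> states M"
  shows "state_poss M s (paths M) = 1"
proof -
  \<comment> \<open>The supremum 1 of the outgoing possibilities need not be attained, so every
    \<open>c < 1\<close> is approached separately.\<close>
  have "c \<le> state_poss M s (paths M)" if c: "0 \<le> c" "c < 1" for c
  proof -
    have "\<exists>u. u \<in> states M \<and> c < trans_poss M t u" if t: "t \<in> states M" for t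
    proof (rule ccontr)
      assume "\<not> ?thesis"
      moreover have "trans_poss M t ` states M \<subseteq> {0..1}"
        using trans_poss_unit[OF K t] by auto
      ultimately have "usup (trans_poss M t ` states M) \<le> c"
        using c(1) by (subst usup_le_iff) (auto simp: not_less)
      moreover have "usup (trans_poss M t ` states M) = 1"
        using K t by (simp add: possibilistic_kripke_def)
      ultimately show False using c(2) by simp
    qed
    \<comment> \<open>Iterating a choice of successors with possibility above \<open>c\<close> gives
      an infinite path whose infimum is still at least \<open>c\<close>.\<close>
    then obtain f where f: "\<And>t. t \<in> states M \<Longrightarrow> f t \<in> states M \<and> c < trans_poss M t (f t)"
      by metis
    let ?\<pi> = "\<lambda>i. (f ^^ i) s"
    have st: "?\<pi> i \<in> states M" for i using f s by (induction i) auto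
    have step: "c < trans_poss M (?\<pi> i) (?\<pi> (Suc i))" for i using f[OF st[of i]] by simp
    have "c \<le> run_poss M ?\<pi>"
      unfolding run_poss_def using step by (intro cINF_greatest) (auto intro: less_imp_le)
    also have "?\<pi> \<in> paths M"
      using st le_less_trans[OF c(1) step] by (simp add: paths_def)
    then have "run_poss M ?\<pi> \<le> state_poss M s (paths M)"
      by (intro run_le_state_poss[OF K]) (auto simp: paths_from_def)
    finally show ?thesis .
  qed
  moreover have "state_poss M s (paths M) \<in> {0..1}" by (rule state_poss_unit[OF K])
  ultimately show ?thesis
    using dense_ge_bounded[of 0 1 "state_poss M s (paths M)"]
      dense_le_bounded[of 0 1 "state_poss M s (paths M)"] by force
qed

text \<open>The witness \<open>k = 0\<close> works for every path from \<open>s\<close>, so the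
  event is no restriction.\<close>

lemma state_poss_bounded_until_goal:
  assumes "possibilistic_kripke M" "s \<in> states M" "s \<in> D"
  shows "state_poss M s (bounded_until M C n D) = 1"
proof -
  have "bounded_until M C n D \<inter> paths_from M s = paths M \<inter> paths_from M s"
    using assms(3) by (auto simp: bounded_until_def paths_from_def)
  then show ?thesis
    using state_poss_paths[OF assms(1,2)] by (simp add: state_poss_eq[OF assms(1)])
qed

lemma state_poss_bounded_until_0:
  assumes "possibilistic_kripke M" "s \<notin> D"
  shows "state_poss M s (bounded_until M C 0 D) = 0"
proof -
  have "bounded_until M C 0 D \<inter> paths_from M s = {}"
    using assms(2) by (auto simp: bounded_until_def paths_from_def)
  then show ?thesis by (simp add: state_poss_eq[OF assms(1)] usup_def)
qed

lemma state_poss_bounded_until_blocked: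
  assumes "possibilistic_kripke M" "s \<notin> C \<union> D"
  shows "state_poss M s (bounded_until M C n D) = 0"
proof -
  have "bounded_until M C n D \<inter> paths_from M s = {}"
    using assms(2) by (auto simp: bounded_until_def paths_from_def)
  then show ?thesis by (simp add: state_poss_eq[OF assms(1)] usup_def)
qed

section \<open>The max-min operator\<close>

lemma maxmin_affine_mono:
  assumes "\<And>s t. s \<in> T \<Longrightarrow> t \<in> T \<Longrightarrow> A s t \<in> {0..1}"
    and "Y \<in> T \<rightarrow>\<^sub>E {0..1}" "Z \<in> T \<rightarrow>\<^sub>E {0..1}"
    and "\<And>t. t \<in> T \<Longrightarrow> Y t \<le> Z t" and s: "s \<in> T"
  shows "maxmin_affine T A b Y s \<le> maxmin_affine T A b Z s"
proof -
  have "usup ((\<lambda>t. min (A s t) (Y t)) ` T) \<le> usup ((\<lambda>t. min (A s t) (Z t)) ` T)"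
    using assms(1)[OF s] assms(4) PiE_mem[OF assms(2)] PiE_mem[OF assms(3)]
    by (intro usup_image_mono) (auto simp: min_def intro: order_trans)
  then show ?thesis using s by (auto simp: maxmin_affine_def maxmin_prod_def)
qed

text \<open>Splitting the supremum along the three classes: \<open>S0\<close> contributes 0,
  \<open>S1\<close> contributes the constant vector because \<open>q\<close> is 1 there, and
  \<open>T\<close> contributes the max-min product.\<close>

lemma usup_trans_eq_maxmin_affine:
  assumes K: "possibilistic_kripke M" and part: "states M = S0 \<union> S1 \<union> T"
    and q: "\<And>t. t \<in> states M \<Longrightarrow> q t \<in> {0..1}"
    and q0: "\<And>t. t \<in> S0 \<Longrightarrow> q t = 0" and q1: "\<And>t. t \<in> S1 \<Longrightarrow> q t = 1"
    and s: "s \<in> T"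
  shows "usup ((\<lambda>t. min (trans_poss M s t) (q t)) ` states M) =
    maxmin_affine T (\<lambda>s\<in>T. \<lambda>t\<in>T. trans_poss M s t) (\<lambda>s\<in>T. trans_set M s S1) (\<lambda>t\<in>T. q t) s"
proof -
  let ?g = "\<lambda>t. min (trans_poss M s t) (q t)"
  have P: "trans_poss M s t \<in> {0..1}" if "t \<in> states M" for t
    using trans_poss_unit[OF K _ that] s part by blast
  have g: "?g t \<in> {0..1}" if "t \<in> states M" for t
    using P[OF that] q[OF that] by (auto simp: min_def)
  have sub: "?g ` S0 \<subseteq> {0..1}" "?g ` S1 \<subseteq> {0..1}" "?g ` T \<subseteq> {0..1}"
    using g part by auto
  have "?g t = 0" if "t \<in> S0" for t using P[of t] q0[OF that] that part by auto
  then have "usup (?g ` S0) \<le> 0" by (subst usup_le_iff[OF sub(1)]) auto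
  moreover have "?g ` S1 = trans_poss M s ` S1"
    using P q1 part by (intro image_cong) auto
  moreover have "usup (?g ` states M) = max (max (usup (?g ` S0)) (usup (?g ` S1))) (usup (?g ` T))"
    using sub by (simp add: part image_Un usup_Un)
  moreover have "0 \<le> usup (?g ` T)" using usup_unit[OF sub(3)] by auto
  moreover have "(\<lambda>t. min ((\<lambda>t\<in>T. trans_poss M s t) t) ((\<lambda>t\<in>T. q t) t)) ` T = ?g ` T"
    by (intro image_cong) auto
  ultimately show ?thesis
    using s by (auto simp: maxmin_affine_def maxmin_prod_def trans_set_def)
qed

section \<open>Least fixed point and convergence of the iteration\<close>

theorem theorem11:
  fixes M :: "('s, 'p) kripke"
    and B C S0 S1 Sq :: "'s set"
    and A :: "'s \<Rightarrow> 's \<Rightarrow> real"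
    and b X :: "'s \<Rightarrow> real"
    and Phi :: "('s \<Rightarrow> real) \<Rightarrow> 's \<Rightarrow> real"
    and XX :: "nat \<Rightarrow> 's \<Rightarrow> real"
  assumes "possibilistic_kripke M"
    and "B \<subseteq> states M" and "C \<subseteq> states M"
    and "S0 \<inter> S1 = {}"
    and "B \<subseteq> S1"
    and "S1 \<subseteq> {s \<in> states M. state_poss M s (until M C B) = 1}"
    and "states M - (C \<union> B) \<subseteq> S0"
    and "S0 \<subseteq> {s \<in> states M. state_poss M s (until M C B) = 0}"
    and "Sq = states M - (S1 \<union> S0)"
    and "A = (\<lambda>s\<in>Sq. \<lambda>t\<in>Sq. trans_poss M s t)"
    and "b = (\<lambda>s\<in>Sq. trans_set M s S1)"
    and "Phi = maxmin_affine Sq A b"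
    and "X = (\<lambda>s\<in>Sq. state_poss M s (until M C B))"
    and "XX 0 = (\<lambda>s\<in>Sq. 0)"
    and "\<And>n. XX (Suc n) = Phi (XX n)"
  shows "(X \<in> Sq \<rightarrow>\<^sub>E {0..1} \<and> Phi X = X \<and>
            (\<forall>Y \<in> Sq \<rightarrow>\<^sub>E {0..1}. Phi Y = Y \<longrightarrow> (\<forall>s\<in>Sq. X s \<le> Y s))) \<and>
         (\<forall>n. XX n = (\<lambda>s\<in>Sq. state_poss M s (bounded_until M C n S1))) \<and>
         (\<forall>n. \<forall>s\<in>Sq. XX n s \<le> XX (Suc n) s \<and> XX n s \<le> X s) \<and>
         (\<forall>s\<in>Sq. (\<lambda>n. XX n s) \<longlonglongrightarrow> X s)"
proof -
  note K = assms(1) and Sq = assms(9) and Xdef = assms(13)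
  let ?x = "\<lambda>s. state_poss M s (until M C B)"
  let ?p = "\<lambda>n s. state_poss M s (bounded_until M C n S1)"
  have part: "states M = S0 \<union> S1 \<union> Sq" using assms(6,8) Sq by auto
  have x0: "?x t = 0" if "t \<in> S0" for t using assms(8) that by auto
  have x1: "?x t = 1" if "t \<in> S1" for t using assms(6) that by auto
  have p1: "?p n t = 1" if "t \<in> S1" for n t
    using that part by (intro state_poss_bounded_until_goal[OF K]) auto
  have in_C: "s \<in> C" "s \<in> states M" "s \<notin> S1" "s \<notin> B" if "s \<in> Sq" for s
    using that Sq assms(5,7) by auto
  have min_unit: "min (trans_poss M s t) (state_poss M t E) \<in> {0..1}"
    if "s \<in> states M" "t \<in> states M" for s t E
    using trans_poss_unit[OF K that] state_poss_unit[OF K, of t E] by (auto simp: min_def)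

  \<comment> \<open>Inclusion of events does not give this: \<open>S1\<close> may be larger than
    \<open>B\<close>, and a path that reaches \<open>S1\<close> need not reach \<open>B\<close>. The
    induction therefore compares the two recursions, over all states at once.\<close>
  have p_le_x: "?p n s \<le> ?x s" if "s \<in> states M" for n s
    using that
  proof (induction n arbitrary: s)
    case 0
    then show ?case
      using state_poss_bounded_until_0[OF K, of s S1 C] x1[of s] p1[of s 0]
        state_poss_unit[OF K, of s "until M C B"]
      by (cases "s \<in> S1") auto
  next
    case (Suc n)
    consider "s \<in> S1" | "s \<notin> C \<union> S1" | "s \<in> C" "s \<notin> S1" by blast
    then show ?case
    proof cases
      case 1
      then show ?thesis using x1 p1 by simp
    next
      case 2
      then show ?thesis
        using state_poss_bounded_until_blocked[OF K 2] state_poss_unit[OF K, of s "until M C B"]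
        by simp
    next
      case 3
      then have "s \<notin> B" using assms(5) by auto
      have "usup ((\<lambda>t. min (trans_poss M s t) (?p n t)) ` states M)
          \<le> usup ((\<lambda>t. min (trans_poss M s t) (?x t)) ` states M)"
      proof (rule usup_image_mono)
        show "min (trans_poss M s t) (?p n t) \<le> min (trans_poss M s t) (?x t)"
          if "t \<in> states M" for t
          using Suc.IH[OF that] by (intro min.mono) auto
      qed (use min_unit Suc.prems in blast)+
      then show ?thesis
        using state_poss_bounded_until_step[OF K Suc.prems 3, of n]
          state_poss_until_step[OF K Suc.prems 3(1) \<open>s \<notin> B\<close>] by linarith
    qed
  qed
  \<comment> \<open>The value is squeezed between 0 and \<open>?x t = 0\<close>.\<close>
  have p0: "?p n t = 0" if "t \<in> S0" for n t
    using p_le_x[of t n] x0[OF that] state_poss_unit[OF K, of t "bounded_until M C n S1"] that part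
    by auto

  \<comment> \<open>A path in \<open>C U B\<close> hits \<open>B \<subseteq> S1\<close> at some
    position \<open>k\<close>, so its possibility is bounded by \<open>?p k s\<close>. Both
    leastness and convergence rest on this.\<close>
  have x_le: "?x s \<le> c" if "\<And>n. ?p n s \<le> c" for s c
  proof -
    have "0 \<le> c" using that[of 0] state_poss_unit[OF K, of s "bounded_until M C 0 S1"] by auto
    moreover have "run_poss M \<pi> \<le> c" if \<pi>: "\<pi> \<in> until M C B" "\<pi> \<in> paths_from M s" for \<pi>
    proof -
      obtain k where "\<pi> \<in> bounded_until M C k S1"
        using \<pi>(1) assms(5) by (auto simp: until_def bounded_until_def)
      then show ?thesis
        using run_le_state_poss[OF K _ \<pi>(2)] \<open>?p k s \<le> c\<close> by (blast intro: order_trans)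
    qed
    ultimately show ?thesis by (subst state_poss_le_iff[OF K]) auto
  qed

  have step: "usup ((\<lambda>t. min (trans_poss M s t) (state_poss M t E)) ` states M) =
      Phi (\<lambda>t\<in>Sq. state_poss M t E) s"
    if "s \<in> Sq" "\<And>t. t \<in> S0 \<Longrightarrow> state_poss M t E = 0" "\<And>t. t \<in> S1 \<Longrightarrow> state_poss M t E = 1" for s E
    unfolding assms(10-12)
    using that state_poss_unit[OF K] by (intro usup_trans_eq_maxmin_affine[OF K part]) auto
  \<comment> \<open>Vectors are functions fixed to \<open>undefined\<close> outside
    \<open>Sq\<close>, so equality of vectors must also be checked there.\<close>
  have ext: "Phi Y s = undefined" if "s \<notin> Sq" for Y s
    using that by (simp add: assms(12) maxmin_affine_def)

  have X_fix: "Phi X = X"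
  proof
    fix s
    show "Phi X s = X s"
    proof (cases "s \<in> Sq")
      case True
      have "?x s = Phi (\<lambda>t\<in>Sq. ?x t) s"
        using state_poss_until_step[OF K in_C(2,1,4)[OF True]] step[OF True x0 x1] by (rule trans)
      then show ?thesis using True by (simp add: Xdef)
    qed (simp add: ext Xdef)
  qed
  have X_unit: "X \<in> Sq \<rightarrow>\<^sub>E {0..1}"
    unfolding Xdef using state_poss_unit[OF K] by auto
  have XX: "XX n = (\<lambda>s\<in>Sq. ?p n s)" for n
  proof (induction n)
    case 0
    show ?case
      using state_poss_bounded_until_0[OF K, of _ S1 C] in_C(3)
      by (auto simp: assms(14) restrict_def)
  next
    case (Suc n)
    show ?case
    proof
      fix s
      show "XX (Suc n) s = (\<lambda>s\<in>Sq. ?p (Suc n) s) s"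
      proof (cases "s \<in> Sq")
        case True
        have "?p (Suc n) s = Phi (\<lambda>t\<in>Sq. ?p n t) s"
          using state_poss_bounded_until_step[OF K in_C(2,1,3)[OF True]] step[OF True p0 p1]
          by (rule trans)
        then show ?thesis unfolding assms(15) Suc.IH using True by simp
      qed (simp add: ext assms(15))
    qed
  qed
  have XX_unit: "XX n \<in> Sq \<rightarrow>\<^sub>E {0..1}" for n
    unfolding XX using state_poss_unit[OF K] by auto
  have A_unit: "A s t \<in> {0..1}" if "s \<in> Sq" "t \<in> Sq" for s t
    using trans_poss_unit[OF K, of s t] that in_C(2) by (simp add: assms(10))

  \<comment> \<open>The iteration starts at 0, below \<open>Y\<close>, and monotonicity of
    \<open>Phi\<close> keeps it below the fixed point; \<open>x_le\<close> passes this bound on to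
    \<open>X\<close>.\<close>
  have least: "X s \<le> Y s" if Y: "Y \<in> Sq \<rightarrow>\<^sub>E {0..1}" "Phi Y = Y" and s: "s \<in> Sq" for Y s
  proof -
    have "XX n t \<le> Y t" if "t \<in> Sq" for n t
      using that
    proof (induction n arbitrary: t)
      case 0
      then show ?case using PiE_mem[OF Y(1)] by (auto simp: assms(14))
    next
      case (Suc n)
      have "Phi (XX n) t \<le> Phi Y t"
        unfolding assms(12)
        using maxmin_affine_mono[OF A_unit XX_unit Y(1) Suc.IH Suc.prems] .
      then show ?case by (simp add: assms(15) Y(2))
    qed
    then show ?thesis using s x_le[of s "Y s"] by (simp add: XX Xdef)
  qed

  have p_mono: "?p m s \<le> ?p n s" if "m \<le> n" for m n s
  proof (rule state_poss_mono[OF K])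
    show "bounded_until M C m S1 \<subseteq> bounded_until M C n S1"
      using that unfolding bounded_until_def by (blast intro: order_trans)
  qed
  have lim: "(\<lambda>n. XX n s) \<longlonglongrightarrow> X s" if s: "s \<in> Sq" for s
  proof (rule order_tendstoI)
    fix a assume "a < X s"
    \<comment> \<open>If no \<open>?p m s\<close> exceeded \<open>a\<close>, then
      \<open>x_le\<close> would give \<open>X s \<le> a\<close>. Monotonicity in \<open>n\<close>
      extends the bound to all later indices.\<close>
    then obtain m where "a < ?p m s"
      using x_le[of s a] s by (auto simp: Xdef not_le[symmetric])
    then show "\<forall>\<^sub>F n in sequentially. a < XX n s"
      using p_mono[of m _ s] s
      by (auto simp: XX eventually_sequentially intro!: exI[of _ m] intro: less_le_trans)
  next
    fix a assume "X s < a"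
    then show "\<forall>\<^sub>F n in sequentially. XX n s < a"
      using p_le_x[OF in_C(2)[OF s]] s
      by (intro always_eventually allI) (auto simp: XX Xdef intro: le_less_trans)
  qed

  have "XX n s \<le> XX (Suc n) s \<and> XX n s \<le> X s" if "s \<in> Sq" for n s
    unfolding XX Xdef using that p_mono[of n "Suc n" s] p_le_x[OF in_C(2)[OF that], of n] by simp
  then show ?thesis
    using X_unit X_fix least XX lim by blast
qed

end
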